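(* There is no weakly admissible map on the $2$-skeleton of $\Delta^{S_4}$; that is, there is no continuous map $u\colon\Delta^{S_4}_{(2)}\to\mathrm{U}(4)$ such that $u(\Delta^{g_0,\ldots,g_l})\subset U_{g_0}\,\mathrm{U}(\mathcal{P}(\Delta^{g_0,\ldots,g_l}))$ for every subsimplex $\Delta^{g_0,\ldots,g_l}\subset\Delta^{S_4}_{(2)}$.
   Context: Let $n\ge1$, $\bar n=\{1,\dots,n\}$, $S_n$ the symmetric group on $\bar n$, with a fixed total order on $S_n$ (e.g. lexicographic). $\Delta^{S_n}$ is the $(n!-1)$-simplex with vertices indexed by $S_n$; its points are $x=\sum_{g\in S_n}x_g g$ with $x_g\ge0$, $\sum_g x_g=1$. For $g_0<\dots<g_k$ in $S_n$, $\Delta^{g_0,\dots,g_k}$ is the $k$-subsimplex spanned by $g_0,\dots,g_k$. The $k$-skeleton $\Delta^{S_n}_{(k)}$ is the union of all $k$-subsimplices. For a subsimplex, $\mathcal{P}(\Delta^{g_0,\dots,g_k})$ is the partition of $\bar n$ into orbits of the subgroup of $S_n$ generated by $g_0^{-1}g_1,\dots,g_0^{-1}g_k$ (for $k=0$, the partition into singletons). For a partition $\mathcal{P}$ of $\bar n$, $\mathrm{U}(\mathcal{P})\subset\mathrm{U}(n)$ is the subgroup of unitary matrices that are block diagonal with respect to $\mathcal{P}$ (the $(i,j)$ entry vanishes unless $i,j$ lie in the same block). $U_g\in\mathrm{U}(n)$ is the permutation matrix $U_ge_i=e_{g(i)}$. *)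

theory Defs
  imports
    "HOL-Analysis.Analysis"
    "HOL-Algebra.Group_Action"
    "HOL-Algebra.Generated_Groups"
begin

section \<open>The simplex on the symmetric group\<close>

text \<open>
  The index set \<open>{1,\<dots>,n}\<close> is rendered as a finite type \<open>'n\<close>, and \<open>S\<^sub>n\<close> as the library group of
  bijections of that type, whose product is composition \<open>g \<otimes> h = g \<circ> h\<close>.
\<close>

abbreviation Sym :: "('n::finite \<Rightarrow> 'n) monoid"
  where "Sym \<equiv> BijGroup UNIV"

text \<open>
  A sequence \<open>g\<^sub>0 < \<dots> < g\<^sub>k\<close> in \<open>S\<^sub>n\<close> is a strictly increasing list of length \<open>k + 1\<close>;
  \<open>r\<close> is the (reflexive) total order on \<open>S\<^sub>n\<close>.
\<close>

definition vertex_seq :: "('n::finite \<Rightarrow> 'n) rel \<Rightarrow> ('n \<Rightarrow> 'n) list \<Rightarrow> bool"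
  where "vertex_seq r gs \<longleftrightarrow>
    gs \<noteq> [] \<and> set gs \<subseteq> carrier Sym \<and> sorted_wrt (\<lambda>g h. (g, h) \<in> r \<and> g \<noteq> h) gs"

text \<open>
  Coordinates are indexed by all functions \<open>'n \<Rightarrow> 'n\<close>, which form a finite type; only permutations
  occur as vertices, so the coordinates at other functions vanish on every subsimplex.
\<close>

definition subsimplex :: "('n::finite \<Rightarrow> 'n) list \<Rightarrow> (real ^ ('n \<Rightarrow> 'n)) set"
  where "subsimplex gs = convex hull ((\<lambda>g. axis g 1) ` set gs)"

definition skeleton :: "('n::finite \<Rightarrow> 'n) rel \<Rightarrow> nat \<Rightarrow> (real ^ ('n \<Rightarrow> 'n)) set"
  where "skeleton r k = \<Union> {subsimplex gs | gs. vertex_seq r gs \<and> length gs = k + 1}"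

definition orbit_partition :: "('n::finite \<Rightarrow> 'n) list \<Rightarrow> 'n set set"
  where "orbit_partition gs =
    orbits (Sym\<lparr>carrier := generate Sym ((\<lambda>g. inv\<^bsub>Sym\<^esub> (hd gs) \<otimes>\<^bsub>Sym\<^esub> g) ` set (tl gs))\<rparr>)
      UNIV (\<lambda>g. g)"


section \<open>Unitary matrices\<close>

definition conj_transpose :: "complex ^ 'n ^ 'm \<Rightarrow> complex ^ 'm ^ 'n"
  where "conj_transpose A = (\<chi> i j. cnj (A $ j $ i))"

definition unitary_mats :: "(complex ^ 'n ^ 'n::finite) set"
  where "unitary_mats = {A. conj_transpose A ** A = mat 1 \<and> A ** conj_transpose A = mat 1}"

definition block_unitary_mats :: "'n set set \<Rightarrow> (complex ^ 'n ^ 'n::finite) set"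
  where "block_unitary_mats P =
    {A \<in> unitary_mats. \<forall>i j. \<not> (\<exists>B\<in>P. i \<in> B \<and> j \<in> B) \<longrightarrow> A $ i $ j = 0}"

definition perm_mat :: "('n \<Rightarrow> 'n) \<Rightarrow> complex ^ 'n ^ 'n::finite"
  where "perm_mat g = (\<chi> i j. if i = g j then 1 else 0)"

lemma perm_mat_axis: "perm_mat g *v axis i 1 = axis (g i) 1"
proof -
  have "(\<Sum>j\<in>UNIV. perm_mat g $ k $ j * axis i 1 $ j) = perm_mat g $ k $ i" for k
    by (simp add: axis_def if_distrib [where f = "\<lambda>z. _ * z"] cong: if_cong)
  then show ?thesis
    by (simp add: matrix_vector_mult_def vec_eq_iff perm_mat_def axis_def)
qed


section \<open>Weakly admissible maps\<close>

definition weakly_admissible ::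
  "('n::finite \<Rightarrow> 'n) rel \<Rightarrow> (real ^ ('n \<Rightarrow> 'n)) set \<Rightarrow> (real ^ ('n \<Rightarrow> 'n) \<Rightarrow> complex ^ 'n ^ 'n) \<Rightarrow> bool"
  where "weakly_admissible r X u \<longleftrightarrow>
    continuous_on X u \<and> u ` X \<subseteq> unitary_mats \<and>
    (\<forall>gs. vertex_seq r gs \<and> subsimplex gs \<subseteq> X \<longrightarrow>
      u ` subsimplex gs \<subseteq> (\<lambda>A. perm_mat (hd gs) ** A) ` block_unitary_mats (orbit_partition gs))"


section \<open>Barycentric coordinates and the case of a single vertex\<close>

lemma mem_subsimplex_iff:
  "x \<in> subsimplex gs \<longleftrightarrow>
    (\<forall>g. x $ g \<ge> 0) \<and> (\<Sum>g\<in>UNIV. x $ g) = 1 \<and> (\<forall>g. g \<notin> set gs \<longrightarrow> x $ g = 0)"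
proof -
  let ?e = "\<lambda>g. axis g (1::real)"
  have inj: "inj_on ?e (set gs)"
    by (auto simp: inj_on_def axis_eq_axis)
  have coord: "(\<Sum>g\<in>set gs. c g *\<^sub>R ?e g) $ h = (if h \<in> set gs then c h else 0)" for c h
    by (simp add: axis_def if_distrib cong: if_cong)
  show ?thesis
  proof
    assume "x \<in> subsimplex gs"
    then obtain c where c: "\<forall>y\<in>?e ` set gs. 0 \<le> c y" "sum c (?e ` set gs) = 1"
      "(\<Sum>y\<in>?e ` set gs. c y *\<^sub>R y) = x"
      by (auto simp: subsimplex_def convex_hull_finite)
    have "x = (\<Sum>g\<in>set gs. c (?e g) *\<^sub>R ?e g)"
      using c(3) by (simp add: sum.reindex[OF inj])
    then have x: "x $ h = (if h \<in> set gs then c (?e h) else 0)" for h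
      using coord[of "\<lambda>g. c (?e g)" h] by simp
    have "(\<Sum>g\<in>UNIV. x $ g) = 1"
      using c(2) by (simp add: x sum.reindex[OF inj] sum.If_cases)
    then show "(\<forall>g. x $ g \<ge> 0) \<and> (\<Sum>g\<in>UNIV. x $ g) = 1 \<and> (\<forall>g. g \<notin> set gs \<longrightarrow> x $ g = 0)"
      using c(1) by (auto simp: x)
  next
    assume x: "(\<forall>g. x $ g \<ge> 0) \<and> (\<Sum>g\<in>UNIV. x $ g) = 1 \<and> (\<forall>g. g \<notin> set gs \<longrightarrow> x $ g = 0)"
    have "sum (\<lambda>g. x $ g) (set gs) = 1"
      using x sum.mono_neutral_left[of UNIV "set gs" "\<lambda>g. x $ g"] by simp
    moreover have "(\<Sum>g\<in>set gs. x $ g *\<^sub>R ?e g) = x"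
      using x coord[of "\<lambda>g. x $ g"] unfolding vec_eq_iff by metis
    moreover have "(\<Sum>g\<in>set gs. x $ g *\<^sub>R ?e g) \<in> convex hull (?e ` set gs)"
      using x calculation(1)
      by (intro convex_sum) (auto intro: hull_inc)
    ultimately show "x \<in> subsimplex gs"
      by (simp add: subsimplex_def)
  qed
qed

lemma orbit_partition_single: "orbit_partition [g :: 'a::finite \<Rightarrow> 'a] = {{i} | i. True}"
proof -
  have "generate Sym {} = {\<lambda>x::'a. x}"
    using group.generate_empty[OF group_BijGroup[of "UNIV :: 'a set"]]
    by (simp add: BijGroup_def restrict_UNIV)
  then show ?thesis
    by (simp add: orbit_partition_def orbits_def orbit_def)
qed

end

theory Submission
  imports Defs
begin

text \<open>
  An admissible map \<open>u\<close> would select a logarithm \<open>H\<close> of the sign function on \<open>S\<^sub>4\<close> that obeys linear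
  relations incompatible with the number of odd permutations.

  Suppose that all vertices of an edge or a triangle map a set \<open>B\<close> of columns onto the same set of rows.
  Admissibility says that the corresponding block of \<open>u\<close> is unitary along the whole face. Its determinant
  then has no zero there and, the face being contractible, has a continuous logarithm. So an edge from \<open>g\<close>
  to \<open>h\<close> with \<open>g ` B = h ` B\<close> has a well-defined increment of the logarithm of that block
  (\<open>edge_increment\<close>). The increments satisfy the cocycle relation on triangles
  (\<open>edge_increment_cocycle\<close>) and are additive in \<open>B\<close> (\<open>edge_increment_Un\<close>).

  For the full determinant, and for a single entry \<open>(g i, i)\<close>, the cocycle relation turns the increments
  into differences of functions of the vertex. Their combination
  \<open>H g = log (det (u g)) - (\<Sum>i. log (u g $ g i $ i))\<close> satisfies \<open>exp (H g) = sign g\<close>, because \<open>u\<close> is monomial at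
  the vertices. Blocks with two elements give relations between its values: for every splitting of the four
  points into pairs \<open>{a, b}\<close> and \<open>{c, d}\<close>, with transpositions \<open>\<tau>\<close> and \<open>\<tau>'\<close> of the two pairs,
  the 4-cycle \<open>g, g\<tau>, g\<tau>\<tau>', g\<tau>'\<close> consists of permutations that agree on \<open>{a, b}\<close> as a set, and closing it up gives
  \<open>H g + H (g\<tau>\<tau>') = H (g\<tau>) + H (g\<tau>')\<close> (\<open>log_defect_square\<close>).

  These relations are contradictory (\<open>no_square_balanced_logarithm_of_sign\<close>). Nine of the squares
  cover each of the 18 permutations that move a given point exactly twice, so they force the signed sum of \<open>H\<close> over these
  18 permutations to vanish. The exponential of that sum is the product of their signs, which is \<open>-1\<close>
  because nine of them are odd.
\<close>


section \<open>Increments of the logarithm along a segment\<close>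

text \<open>
  The difference of \<open>L\<close> and \<open>M\<close> takes values in a coset of \<open>2\<pi>i\<int>\<close>, which is discrete, so it
  is constant on a connected set.
\<close>

lemma logarithm_increment_unique:
  fixes L M :: "'a::topological_space \<Rightarrow> complex"
  assumes "connected S" "continuous_on S L" "continuous_on S M"
    and eq: "\<And>z. z \<in> S \<Longrightarrow> exp (L z) = k * exp (M z)"
    and "x \<in> S" "y \<in> S"
  shows "L y - L x = M y - M x"
proof -
  have k: "exp (L z - M z) = k" if "z \<in> S" for z
    using eq[OF that] by (simp add: exp_diff)
  have "(\<lambda>z. L z - M z) constant_on S"
  proof (rule continuous_discrete_range_constant[OF \<open>connected S\<close>])
    show "continuous_on S (\<lambda>z. L z - M z)"
      using assms by (intro continuous_intros)
    fix z assume z: "z \<in> S"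
    have "L w - M w = L z - M z" if "w \<in> S" "norm ((L w - M w) - (L z - M z)) < 2 * pi" for w
    proof (rule exp_complex_eqI)
      show "exp (L w - M w) = exp (L z - M z)"
        using k z that by simp
      show "\<bar>Im (L w - M w) - Im (L z - M z)\<bar> < 2 * pi"
        using that(2) abs_Im_le_cmod[of "(L w - M w) - (L z - M z)"] by simp
    qed
    then show "\<exists>e>0. \<forall>w. w \<in> S \<and> L w - M w \<noteq> L z - M z \<longrightarrow> e \<le> norm ((L w - M w) - (L z - M z))"
      by (intro exI[of _ "2 * pi"]) force
  qed
  then obtain c where "\<And>z. z \<in> S \<Longrightarrow> L z - M z = c"
    by (auto simp: constant_on_def)
  with \<open>x \<in> S\<close> \<open>y \<in> S\<close> have "L x - M x = c" "L y - M y = c"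
    by blast+
  then show ?thesis
    by (simp add: algebra_simps)
qed

definition log_increment :: "('a::real_normed_vector \<Rightarrow> complex) \<Rightarrow> 'a \<Rightarrow> 'a \<Rightarrow> complex"
  where "log_increment f x y =
    (THE w. \<exists>L. continuous_on (closed_segment x y) L \<and>
      (\<forall>z\<in>closed_segment x y. exp (L z) = f z) \<and> w = L y - L x)"

text \<open>
  The freedom of a constant factor matters: a change of the base permutation of a block multiplies
  its determinant by a constant, and the increments must not see this.
\<close>

lemma log_increment_eqI:
  assumes L: "continuous_on (closed_segment x y) L"
    and "c \<noteq> 0" and f: "\<And>z. z \<in> closed_segment x y \<Longrightarrow> f z = c * exp (L z)"
  shows "log_increment f x y = L y - L x"
  unfolding log_increment_def
proof (rule the_equality)
  show "\<exists>M. continuous_on (closed_segment x y) M \<and>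
      (\<forall>z\<in>closed_segment x y. exp (M z) = f z) \<and> L y - L x = M y - M x"
    using L f \<open>c \<noteq> 0\<close>
    by (intro exI[of _ "\<lambda>z. L z + Ln c"]) (auto intro!: continuous_intros simp: exp_add)
next
  fix w
  assume "\<exists>M. continuous_on (closed_segment x y) M \<and>
      (\<forall>z\<in>closed_segment x y. exp (M z) = f z) \<and> w = M y - M x"
  then obtain M where M: "continuous_on (closed_segment x y) M" "w = M y - M x"
      "\<And>z. z \<in> closed_segment x y \<Longrightarrow> exp (M z) = f z"
    by blast
  have "M y - M x = L y - L x"
    by (rule logarithm_increment_unique[of "closed_segment x y" _ _ c]) (use M L f in auto)
  then show "w = L y - L x"
    using M by simp
qed

lemma exists_logarithm_on_convex:
  fixes f :: "'a::real_normed_vector \<Rightarrow> complex"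
  assumes "convex S" "continuous_on S f" "\<And>z. z \<in> S \<Longrightarrow> f z \<noteq> 0"
  obtains L where "continuous_on S L" "\<And>z. z \<in> S \<Longrightarrow> f z = exp (L z)"
  using continuous_logarithm_on_contractible[OF assms(2) convex_imp_contractible[OF assms(1)]] assms(3)
  by metis


section \<open>Determinants of diagonal blocks\<close>

text \<open>
  Padding a block with ones on the remaining diagonal, instead of cutting it out, keeps all blocks in
  one matrix type, so that the multiplicativity of the determinant applies to them directly.
\<close>

definition block_part :: "'n set \<Rightarrow> complex ^ 'n ^ 'n \<Rightarrow> complex ^ 'n ^ 'n::finite"
  where "block_part B A = (\<chi> i j. if i \<in> B \<and> j \<in> B then A $ i $ j else if i = j then 1 else 0)"

definition block_det :: "'n set \<Rightarrow> ('n \<Rightarrow> 'n) \<Rightarrow> complex ^ 'n ^ 'n \<Rightarrow> complex"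
  where "block_det B g A = det (block_part B (\<chi> i. A $ g i))"

lemma block_part_UNIV: "block_part UNIV A = A"
  by (simp add: block_part_def vec_eq_iff)

lemma block_part_mat_1: "block_part B (mat 1) = mat 1"
  by (simp add: block_part_def mat_def vec_eq_iff)

lemma block_det_singleton: "block_det {i} g A = A $ g i $ i"
proof -
  have "block_det {i} g A =
      (\<Prod>k\<in>UNIV. block_part {i} (\<chi> i. A $ g i) $ k $ k)"
    unfolding block_det_def by (rule det_diagonal) (auto simp: block_part_def)
  also have "\<dots> = (\<Prod>k\<in>UNIV. if k = i then A $ g i $ i else 1)"
    by (intro prod.cong) (auto simp: block_part_def)
  finally show ?thesis
    by simp
qed

text \<open>
  The rows of \<open>A\<close> in \<open>B\<close> are supported on \<open>B\<close>, so they only combine rows of \<open>C\<close> that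
  also lie in \<open>B\<close>.
\<close>

lemma block_part_mult:
  assumes "\<And>i j. i \<in> B \<Longrightarrow> j \<notin> B \<Longrightarrow> A $ i $ j = 0"
  shows "block_part B (A ** C) = block_part B A ** block_part B C"
proof -
  have "block_part B (A ** C) $ i $ j = (\<Sum>k\<in>UNIV. block_part B A $ i $ k * block_part B C $ k $ j)"
    for i j
  proof (cases "i \<in> B")
    case True
    have "(\<Sum>k\<in>UNIV. block_part B A $ i $ k * block_part B C $ k $ j) =
        (\<Sum>k\<in>UNIV. if j \<in> B then A $ i $ k * C $ k $ j else 0)"
      using True assms by (intro sum.cong) (auto simp: block_part_def)
    then show ?thesis
      using True by (auto simp: block_part_def matrix_matrix_mult_def)
  next
    case False
    have "(\<Sum>k\<in>UNIV. block_part B A $ i $ k * block_part B C $ k $ j) =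
        (\<Sum>k\<in>UNIV. if k = i then block_part B C $ i $ j else 0)"
      using False by (intro sum.cong) (auto simp: block_part_def)
    then show ?thesis
      using False by (simp add: block_part_def)
  qed
  then show ?thesis
    by (simp add: vec_eq_iff matrix_matrix_mult_def)
qed

lemma block_part_Un:
  assumes "B \<inter> C = {}"
    and "\<And>i j. i \<in> B \<Longrightarrow> j \<in> C \<Longrightarrow> A $ i $ j = 0" "\<And>i j. i \<in> C \<Longrightarrow> j \<in> B \<Longrightarrow> A $ i $ j = 0"
  shows "block_part (B \<union> C) A = block_part B A ** block_part C A"
proof -
  have "block_part (B \<union> C) A $ i $ j = (\<Sum>k\<in>UNIV. block_part B A $ i $ k * block_part C A $ k $ j)"
    for i j
  proof (cases "j \<in> C")
    case True
    have "(\<Sum>k\<in>UNIV. block_part B A $ i $ k * block_part C A $ k $ j) =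
        (\<Sum>k\<in>UNIV. if k = i then block_part (B \<union> C) A $ i $ j else 0)"
      using True assms by (intro sum.cong) (auto simp: block_part_def)
    then show ?thesis
      by simp
  next
    case False
    have "(\<Sum>k\<in>UNIV. block_part B A $ i $ k * block_part C A $ k $ j) =
        (\<Sum>k\<in>UNIV. if k = j then block_part (B \<union> C) A $ i $ j else 0)"
      using False assms by (intro sum.cong) (auto simp: block_part_def)
    then show ?thesis
      by simp
  qed
  then show ?thesis
    by (simp add: vec_eq_iff matrix_matrix_mult_def)
qed

lemma permuted_rows_unitary:
  assumes "A \<in> unitary_mats" "inj g"
  shows "(\<chi> i. A $ g i) ** conj_transpose (\<chi> i. A $ g i) = mat 1"
proof -
  have "(A ** conj_transpose A) $ g i $ g j = mat 1 $ g i $ g j" for i j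
    using assms by (simp add: unitary_mats_def)
  then show ?thesis
    using \<open>inj g\<close>
    by (simp add: vec_eq_iff matrix_matrix_mult_def conj_transpose_def mat_def inj_eq)
qed

text \<open>
  A diagonal block of a block unitary matrix is itself unitary.
\<close>

lemma block_det_nonzero:
  assumes "A \<in> unitary_mats" "inj g" and "\<And>i j. i \<in> B \<Longrightarrow> j \<notin> B \<Longrightarrow> A $ g i $ j = 0"
  shows "block_det B g A \<noteq> 0"
proof -
  let ?A = "\<chi> i. A $ g i"
  have "block_part B ?A ** block_part B (conj_transpose ?A) = mat 1"
    using assms by (simp flip: block_part_mult add: permuted_rows_unitary block_part_mat_1)
  then have "det (block_part B ?A) * det (block_part B (conj_transpose ?A)) = 1"
    by (metis det_mul det_I)
  then show ?thesis
    by (auto simp: block_det_def)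
qed

lemma block_det_Un:
  assumes "B \<inter> C = {}"
    and "\<And>i j. i \<in> B \<Longrightarrow> j \<in> C \<Longrightarrow> A $ g i $ j = 0" "\<And>i j. i \<in> C \<Longrightarrow> j \<in> B \<Longrightarrow> A $ g i $ j = 0"
  shows "block_det (B \<union> C) g A = block_det B g A * block_det C g A"
  using assms by (simp add: block_det_def block_part_Un det_mul)

text \<open>
  The rows selected by \<open>h\<close> arise from those selected by \<open>g\<close> by the permutation
  \<open>g\<^sup>-\<^sup>1h\<close>, which preserves \<open>B\<close>; the constant is its sign on \<open>B\<close>.
\<close>

lemma block_det_change_base:
  assumes "bij g" "bij h" "g ` B = h ` B"
  obtains c where "\<And>A. block_det B h A = c * block_det B g A"
proof
  define P :: "complex ^ 'a ^ 'a" where "P = (\<chi> i j. if g j = h i then 1 else 0)"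
  fix A :: "complex ^ 'a ^ 'a"
  have "(P ** (\<chi> i. A $ g i)) $ i $ j = A $ h i $ j" for i j
  proof -
    obtain k where k: "g k = h i"
      using \<open>bij g\<close> by (metis bij_pointE)
    have "(P ** (\<chi> i. A $ g i)) $ i $ j = (\<Sum>l\<in>UNIV. if l = k then A $ h i $ j else 0)"
      unfolding matrix_matrix_mult_def P_def vec_lambda_beta
      using k bij_is_inj[OF \<open>bij g\<close>] by (intro sum.cong) (auto simp: inj_eq simp flip: k)
    then show ?thesis
      by simp
  qed
  then have "(\<chi> i. A $ h i) = P ** (\<chi> i. A $ g i)"
    by (simp add: vec_eq_iff)
  moreover have "P $ i $ j = 0" if "i \<in> B" "j \<notin> B" for i j
  proof -
    have "g j \<notin> g ` B"
      using that bij_is_inj[OF \<open>bij g\<close>] by (simp add: inj_image_mem_iff)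
    then show ?thesis
      using that \<open>g ` B = h ` B\<close> by (auto simp: P_def)
  qed
  ultimately show "block_det B h A = det (block_part B P) * block_det B g A"
    by (simp add: block_det_def block_part_mult det_mul)
qed

lemma continuous_on_block_det:
  fixes u :: "'a::topological_space \<Rightarrow> complex ^ 'n ^ 'n::finite"
  assumes "continuous_on S u"
  shows "continuous_on S (\<lambda>x. block_det B g (u x))"
proof -
  have "continuous_on S (\<lambda>x. u x $ i $ j)" for i j
    using assms by (intro continuous_intros)
  then have "continuous_on S (\<lambda>x. block_part B (\<chi> i. u x $ g i) $ i $ j)" for i j
    by (cases "i \<in> B \<and> j \<in> B") (auto simp: block_part_def)
  then show ?thesis
    unfolding block_det_def det_def
    by (intro continuous_on_sum continuous_on_mult continuous_on_const continuous_on_prod)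
qed


section \<open>Logarithms of determinants along the edges\<close>

abbreviation vertex :: "('n::finite \<Rightarrow> 'n) \<Rightarrow> real ^ ('n \<Rightarrow> 'n)"
  where "vertex g \<equiv> axis g 1"

abbreviation face :: "('n::finite \<Rightarrow> 'n) set \<Rightarrow> (real ^ ('n \<Rightarrow> 'n)) set"
  where "face S \<equiv> convex hull (vertex ` S)"

abbreviation swap :: "'a \<Rightarrow> 'a \<Rightarrow> 'a \<Rightarrow> 'a"
  where "swap \<equiv> Transposition.transpose"

text \<open>
  This is what weak admissibility gives on faces of dimension at most two, in a form that mentions
  no base vertex, no generated subgroup and no order of the vertices. Columns in \<open>B\<close> can only meet rows in
  \<open>B'\<close> as soon as all vertices of the face map \<open>B\<close> onto \<open>B'\<close>, because such a \<open>B\<close> is a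
  union of orbits of the permutations \<open>g\<^sup>-\<^sup>1h\<close>.
\<close>

locale block_unitary_field =
  fixes u :: "real ^ ('n::finite \<Rightarrow> 'n) \<Rightarrow> complex ^ 'n ^ 'n"
  assumes continuous: "S \<subseteq> {g. bij g} \<Longrightarrow> S \<noteq> {} \<Longrightarrow> card S \<le> 3 \<Longrightarrow> continuous_on (face S) u"
    and unitary: "S \<subseteq> {g. bij g} \<Longrightarrow> S \<noteq> {} \<Longrightarrow> card S \<le> 3 \<Longrightarrow> x \<in> face S \<Longrightarrow> u x \<in> unitary_mats"
    and support: "S \<subseteq> {g. bij g} \<Longrightarrow> S \<noteq> {} \<Longrightarrow> card S \<le> 3 \<Longrightarrow> x \<in> face S \<Longrightarrow>
      (\<And>g. g \<in> S \<Longrightarrow> g ` B = B') \<Longrightarrow> (j \<in> B) \<noteq> (i \<in> B') \<Longrightarrow> u x $ i $ j = 0"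
begin

lemma block_support:
  assumes "S \<subseteq> {g. bij g}" "S \<noteq> {}" "card S \<le> 3" "x \<in> face S" "\<And>h. h \<in> S \<Longrightarrow> h ` B = g ` B" "inj g"
    and "(i \<in> B) \<noteq> (j \<in> B)"
  shows "u x $ g i $ j = 0"
proof -
  have "(j \<in> B) \<noteq> (g i \<in> g ` B)"
    using assms by (auto simp: inj_image_mem_iff)
  then show ?thesis
    using support[OF assms(1-5)] by blast
qed

definition edge_increment :: "'n set \<Rightarrow> ('n \<Rightarrow> 'n) \<Rightarrow> ('n \<Rightarrow> 'n) \<Rightarrow> complex"
  where "edge_increment B g h = log_increment (\<lambda>x. block_det B g (u x)) (vertex g) (vertex h)"

lemma exists_block_logarithm:
  assumes S: "S \<subseteq> {g. bij g}" "S \<noteq> {}" "card S \<le> 3" and "bij g" and "\<And>h. h \<in> S \<Longrightarrow> h ` B = g ` B"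
  obtains L where "continuous_on (face S) L" "\<And>x. x \<in> face S \<Longrightarrow> block_det B g (u x) = exp (L x)"
proof (rule exists_logarithm_on_convex)
  show "convex (face S)"
    by (rule convex_convex_hull)
  show "continuous_on (face S) (\<lambda>x. block_det B g (u x))"
    by (intro continuous_on_block_det continuous S)
  show "block_det B g (u x) \<noteq> 0" if "x \<in> face S" for x
  proof (rule block_det_nonzero)
    show "u x \<in> unitary_mats" using unitary S that .
    show "inj g" using \<open>bij g\<close> by (rule bij_is_inj)
    then show "u x $ g i $ j = 0" if "i \<in> B" "j \<notin> B" for i j
      using block_support[OF S \<open>x \<in> face S\<close>] assms that by blast
  qed
qed (use that in blast)

text \<open>
  The base \<open>h\<close> of the increment may differ from the base \<open>g\<close> of the logarithm, so one logarithm
  on a triangle computes the increments along all three sides.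
\<close>

lemma edge_increment_eqI:
  assumes g: "bij g" and S: "g \<in> S" "h \<in> S" "k \<in> S" and "bij h" and same: "h ` B = g ` B"
    and L: "continuous_on (face S) L" "\<And>x. x \<in> face S \<Longrightarrow> block_det B g (u x) = exp (L x)"
  shows "edge_increment B h k = L (vertex k) - L (vertex h)"
proof -
  have sub: "closed_segment (vertex h) (vertex k) \<subseteq> face S"
    using S by (intro closed_segment_subset) (auto intro: hull_inc convex_convex_hull)
  obtain c where c: "\<And>A. block_det B h A = c * block_det B g A"
    using block_det_change_base[OF \<open>bij g\<close> \<open>bij h\<close>] same by metis
  obtain c' where c': "\<And>A. block_det B g A = c' * block_det B h A"
    using block_det_change_base[OF \<open>bij h\<close> \<open>bij g\<close>] same by metis
  have "vertex g \<in> face S"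
    using S by (auto intro: hull_inc)
  then have "c \<noteq> 0"
    using c c' L by (metis exp_not_eq_zero mult_zero_left mult_zero_right)
  then show ?thesis
    unfolding edge_increment_def using c L sub
    by (intro log_increment_eqI) (auto intro: continuous_on_subset)
qed

text \<open>
  The triangle is contractible and the block determinant has no zero on it, so a single
  logarithm exists there and its increments add up along the boundary.
\<close>

lemma edge_increment_cocycle:
  assumes bij: "bij g" "bij h" "bij k" and "h ` B = g ` B" "k ` B = g ` B"
  shows "edge_increment B g h + edge_increment B h k = edge_increment B g k"
proof -
  let ?S = "{g, h, k}"
  have S: "?S \<subseteq> {g. bij g}" "?S \<noteq> {}" "card ?S \<le> 3"
    using bij by (auto simp: card_insert_if)
  then obtain L where L: "continuous_on (face ?S) L"
      "\<And>x. x \<in> face ?S \<Longrightarrow> block_det B g (u x) = exp (L x)"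
    by (rule exists_block_logarithm[where g = g and B = B]) (use assms in auto)
  have "edge_increment B a b = L (vertex b) - L (vertex a)" if "a \<in> ?S" "b \<in> ?S" for a b
    by (rule edge_increment_eqI[OF \<open>bij g\<close> _ _ _ _ _ L]) (use that assms in auto)
  then show ?thesis
    by simp
qed

lemma edge_increment_self:
  assumes "bij g"
  shows "edge_increment B g g = 0"
  using edge_increment_cocycle[of g g g B] assms by simp

lemma exp_edge_increment:
  assumes bij: "bij g" "bij h" and "h ` B = g ` B"
  shows "block_det B g (u (vertex h)) = block_det B g (u (vertex g)) * exp (edge_increment B g h)"
proof -
  let ?S = "{g, h}"
  have S: "?S \<subseteq> {g. bij g}" "?S \<noteq> {}" "card ?S \<le> 3"
    using bij by (auto simp: card_insert_if)
  then obtain L where L: "continuous_on (face ?S) L"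
      "\<And>x. x \<in> face ?S \<Longrightarrow> block_det B g (u x) = exp (L x)"
    by (rule exists_block_logarithm[where g = g and B = B]) (use assms in auto)
  have "edge_increment B g h = L (vertex h) - L (vertex g)"
    by (rule edge_increment_eqI[OF \<open>bij g\<close> _ _ _ _ _ L]) (use assms in auto)
  moreover have "vertex g \<in> face ?S" "vertex h \<in> face ?S"
    by (auto intro: hull_inc)
  ultimately show ?thesis
    by (simp add: L exp_diff)
qed

text \<open>
  On the edge the matrix splits further along \<open>B\<close> and \<open>C\<close>, so the determinant of the joint block
  is the product of the two.
\<close>

lemma edge_increment_Un:
  assumes bij: "bij g" "bij h" and B: "h ` B = g ` B" and C: "h ` C = g ` C" and "B \<inter> C = {}"
  shows "edge_increment (B \<union> C) g h = edge_increment B g h + edge_increment C g h"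
proof -
  let ?S = "{g, h}"
  have S: "?S \<subseteq> {g. bij g}" "?S \<noteq> {}" "card ?S \<le> 3"
    using bij by (auto simp: card_insert_if)
  obtain L where L: "continuous_on (face ?S) L"
      "\<And>x. x \<in> face ?S \<Longrightarrow> block_det B g (u x) = exp (L x)"
    using S by (rule exists_block_logarithm[where g = g and B = B]) (use assms in auto)
  obtain M where M: "continuous_on (face ?S) M"
      "\<And>x. x \<in> face ?S \<Longrightarrow> block_det C g (u x) = exp (M x)"
    using S by (rule exists_block_logarithm[where g = g and B = C]) (use assms in auto)
  have BC: "block_det (B \<union> C) g (u x) = exp (L x + M x)" if x: "x \<in> face ?S" for x
  proof -
    have zero: "u x $ g i $ j = 0" if "(i \<in> B) \<noteq> (j \<in> B)" for i j
      by (rule block_support[OF S x _ bij_is_inj that]) (use assms in auto)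
    have "block_det (B \<union> C) g (u x) = block_det B g (u x) * block_det C g (u x)"
      using \<open>B \<inter> C = {}\<close> by (intro block_det_Un zero) auto
    then show ?thesis
      using L M x by (simp add: exp_add)
  qed
  have "edge_increment B g h = L (vertex h) - L (vertex g)"
    by (rule edge_increment_eqI[OF \<open>bij g\<close> _ _ _ _ _ L]) (use assms in auto)
  moreover have "edge_increment C g h = M (vertex h) - M (vertex g)"
    by (rule edge_increment_eqI[OF \<open>bij g\<close> _ _ _ _ _ M]) (use assms in auto)
  moreover have "edge_increment (B \<union> C) g h = (L (vertex h) + M (vertex h)) - (L (vertex g) + M (vertex g))"
    by (rule edge_increment_eqI[OF \<open>bij g\<close> _ _ _ _ _ continuous_on_add[OF L(1) M(1)] BC])
      (use assms in auto)
  ultimately show ?thesis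
    by simp
qed


section \<open>The logarithmic defect\<close>

text \<open>
  By the cocycle property, the logarithm of the full determinant, and likewise that of a single entry,
  becomes a function of the vertex once its increments are taken from a base vertex.
\<close>

definition log_total :: "('n \<Rightarrow> 'n) \<Rightarrow> complex"
  where "log_total g = Ln (det (u (vertex id))) + edge_increment UNIV id g"

text \<open>
  The edge from the transposition of \<open>i\<close> and \<open>g i\<close> to \<open>g\<close> joins two permutations that agree
  at \<open>i\<close>, so the entry at \<open>(g i, i)\<close> has no zero along it. The transposition is determined by
  \<open>g i\<close>, so permutations that agree at \<open>i\<close> are compared with the same base vertex.
\<close>

definition log_entry :: "'n \<Rightarrow> ('n \<Rightarrow> 'n) \<Rightarrow> complex"
  where "log_entry i g =
    Ln (u (vertex (swap i (g i))) $ g i $ i) + edge_increment {i} (swap i (g i)) g"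

text \<open>
  A matrix assigned to a vertex \<open>g\<close> is monomial, so its determinant is the product of the entries
  \<open>(g i, i)\<close> up to the sign of \<open>g\<close>. The defect is therefore a logarithm of the sign, but one
  selected by the continuous map and not by convention.
\<close>

definition log_defect :: "('n \<Rightarrow> 'n) \<Rightarrow> complex"
  where "log_defect g = log_total g - (\<Sum>i\<in>UNIV. log_entry i g)"

lemma edge_increment_total:
  assumes "bij g" "bij h"
  shows "edge_increment UNIV g h = log_total h - log_total g"
  using edge_increment_cocycle[of id g h UNIV] assms
  by (simp add: log_total_def bij_is_surj algebra_simps)

lemma edge_increment_entry:
  assumes "bij g" "bij h" "h i = g i"
  shows "edge_increment {i} g h = log_entry i h - log_entry i g"
  using edge_increment_cocycle[of "swap i (g i)" g h "{i}"] assms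
  by (simp add: log_entry_def algebra_simps)

lemma vertex_value_nonzero:
  assumes "bij g" "block_det B g (u (vertex g)) = d"
  shows "d \<noteq> 0"
proof -
  have "\<exists>L. block_det B g (u (vertex g)) = exp (L (vertex g))"
    by (rule exists_block_logarithm[of "{g}" g B]) (use assms in auto)
  then show ?thesis
    using assms by auto
qed

lemma exp_log_total:
  assumes "bij g"
  shows "exp (log_total g) = det (u (vertex g))"
proof -
  have det: "block_det UNIV id A = det A" for A
    by (simp add: block_det_def block_part_UNIV)
  have "det (u (vertex id)) \<noteq> 0"
    using vertex_value_nonzero[of id UNIV, OF _ refl] by (simp add: det)
  then show ?thesis
    using exp_edge_increment[of id g UNIV] assms
    by (simp add: log_total_def exp_add det bij_is_surj)
qed

lemma exp_log_entry:
  assumes "bij g"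
  shows "exp (log_entry i g) = u (vertex g) $ g i $ i"
proof -
  let ?t = "swap i (g i)"
  have "u (vertex ?t) $ g i $ i \<noteq> 0"
    using vertex_value_nonzero[of ?t "{i}", OF _ refl] by (simp add: block_det_singleton)
  then show ?thesis
    using exp_edge_increment[of ?t g "{i}"] assms
    by (simp add: log_entry_def exp_add block_det_singleton)
qed

lemma det_vertex:
  assumes "bij g"
  shows "det (u (vertex g)) = of_int (sign g) * (\<Prod>i\<in>UNIV. u (vertex g) $ g i $ i)"
proof -
  have "u (vertex g) $ g i $ j = 0" if "i \<noteq> j" for i j
    by (rule block_support[where S = "{g}" and B = "{i}"]) (use assms that in \<open>auto simp: bij_is_inj\<close>)
  then have "det (\<chi> i. u (vertex g) $ g i) = (\<Prod>i\<in>UNIV. u (vertex g) $ g i $ i)"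
    by (subst det_diagonal) auto
  moreover have "det (\<chi> i. u (vertex g) $ g i) = of_int (sign g) * det (u (vertex g))"
    using assms by (intro det_permute_rows bij_imp_permutes) auto
  ultimately have "of_int (sign g) * (of_int (sign g) * det (u (vertex g))) =
      of_int (sign g) * (\<Prod>i\<in>UNIV. u (vertex g) $ g i $ i)"
    by simp
  then show ?thesis
    by (simp flip: mult.assoc of_int_mult)
qed

lemma exp_log_defect:
  assumes "bij g"
  shows "exp (log_defect g) = of_int (sign g)"
proof -
  have "(\<Prod>i\<in>UNIV. u (vertex g) $ g i $ i) \<noteq> 0"
    by (simp flip: exp_log_entry[OF assms])
  then show ?thesis
    using assms
    by (simp add: log_defect_def exp_diff exp_sum exp_log_total exp_log_entry det_vertex)
qed

text \<open>
  The four permutations all map \<open>{a, b}\<close> to the same pair, so the increments of that block add up to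
  zero around the 4-cycle. Along a side that exchanges \<open>c\<close> and \<open>d\<close>, the values at \<open>a\<close> and
  \<open>b\<close> do not change and the block splits into two entries. Along a side that exchanges \<open>a\<close> and
  \<open>b\<close> it is the complement of a block that splits. This expresses the whole cycle through
  functions of the vertices, and these combine to the defect.
\<close>

lemma log_defect_square:
  assumes "bij g" and UNIV: "UNIV = {a, b, c, d}" and "distinct [a, b, c, d]"
  shows "log_defect g + log_defect (g \<circ> swap a b \<circ> swap c d) =
    log_defect (g \<circ> swap a b) + log_defect (g \<circ> swap c d)"
proof -
  define g1 where "g1 = g \<circ> swap a b"
  define g2 where "g2 = g \<circ> swap a b \<circ> swap c d"
  define g3 where "g3 = g \<circ> swap c d"
  have bij: "bij g1" "bij g2" "bij g3"
    using \<open>bij g\<close> by (simp_all add: g1_def g2_def g3_def bij_comp)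
  have val: "g1 a = g b" "g1 b = g a" "g1 c = g c" "g1 d = g d"
    "g2 a = g b" "g2 b = g a" "g2 c = g d" "g2 d = g c"
    "g3 a = g a" "g3 b = g b" "g3 c = g d" "g3 d = g c"
    using assms(3) by (auto simp: g1_def g2_def g3_def transpose_apply_other)
  have img: "g1 ` {a, b} = g ` {a, b}" "g2 ` {a, b} = g ` {a, b}" "g3 ` {a, b} = g ` {a, b}"
    by (auto simp: val)
  have cycle: "edge_increment {a, b} g g1 + edge_increment {a, b} g1 g2 +
      edge_increment {a, b} g2 g3 + edge_increment {a, b} g3 g = 0"
    using edge_increment_cocycle[of g g1 g2 "{a, b}"] edge_increment_cocycle[of g g2 g3 "{a, b}"]
      edge_increment_cocycle[of g g3 g "{a, b}"] edge_increment_self[of g "{a, b}"] bij \<open>bij g\<close> img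
    by simp
  have split: "edge_increment {x, y} h k =
      (log_entry x k - log_entry x h) + (log_entry y k - log_entry y h)"
    if "bij h" "bij k" "k x = h x" "k y = h y" "x \<noteq> y" for h k x y
  proof -
    have "edge_increment ({x} \<union> {y}) h k = edge_increment {x} h k + edge_increment {y} h k"
      using that by (intro edge_increment_Un) auto
    then show ?thesis
      using that by (simp add: edge_increment_entry insert_commute)
  qed
  have compl: "edge_increment {a, b} h k = (log_total k - log_total h) -
      ((log_entry c k - log_entry c h) + (log_entry d k - log_entry d h))"
    if "bij h" "bij k" "k ` {a, b} = h ` {a, b}" "k c = h c" "k d = h d" for h k
  proof -
    have "edge_increment ({a, b} \<union> {c, d}) h k = edge_increment {a, b} h k + edge_increment {c, d} h k"
      using that assms(3) by (intro edge_increment_Un) auto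
    moreover have "{a, b} \<union> {c, d} = UNIV"
      unfolding UNIV by auto
    moreover have "edge_increment {c, d} h k =
        (log_entry c k - log_entry c h) + (log_entry d k - log_entry d h)"
      using that assms(3) by (intro split) auto
    ultimately show ?thesis
      using edge_increment_total[OF that(1,2)] by simp
  qed
  have e01: "edge_increment {a, b} g g1 = (log_total g1 - log_total g) -
      ((log_entry c g1 - log_entry c g) + (log_entry d g1 - log_entry d g))"
    by (rule compl) (use bij \<open>bij g\<close> img val in auto)
  have e12: "edge_increment {a, b} g1 g2 =
      (log_entry a g2 - log_entry a g1) + (log_entry b g2 - log_entry b g1)"
    by (rule split) (use bij val assms(3) in auto)
  have e23: "edge_increment {a, b} g2 g3 = (log_total g3 - log_total g2) -
      ((log_entry c g3 - log_entry c g2) + (log_entry d g3 - log_entry d g2))"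
    by (rule compl) (use bij img val in auto)
  have e30: "edge_increment {a, b} g3 g =
      (log_entry a g - log_entry a g3) + (log_entry b g - log_entry b g3)"
    by (rule split) (use bij \<open>bij g\<close> val assms(3) in auto)
  have defect: "log_defect h =
      log_total h - (log_entry a h + log_entry b h + log_entry c h + log_entry d h)" for h
    unfolding log_defect_def UNIV using assms(3) by simp
  have "log_defect g + log_defect g2 - (log_defect g1 + log_defect g3) = - (edge_increment {a, b} g g1 +
      edge_increment {a, b} g1 g2 + edge_increment {a, b} g2 g3 + edge_increment {a, b} g3 g)"
    unfolding defect e01 e12 e23 e30 by simp
  then show ?thesis
    unfolding cycle by (simp add: g1_def g2_def g3_def)
qed

end


section \<open>A sum over three quarters of the symmetric group\<close>

lemma permutation_of_bij:
  fixes g :: "'n::finite \<Rightarrow> 'n"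
  assumes "bij g"
  shows "permutation g"
  using assms by (simp add: permutation)

lemma sign_comp_swap:
  fixes g :: "'n::finite \<Rightarrow> 'n"
  assumes "bij g" "x \<noteq> y"
  shows "sign (g \<circ> swap x y) = - sign g"
  using assms
  by (simp add: sign_compose permutation_of_bij permutation_swap_id sign_swap_id)

lemma sum_comp_swap:
  fixes F :: "('n \<Rightarrow> 'n) \<Rightarrow> 'b::comm_monoid_add"
  assumes "\<And>g. g \<in> X \<Longrightarrow> g \<circ> swap x y \<in> X"
  shows "(\<Sum>g\<in>X. F (g \<circ> swap x y)) = (\<Sum>g\<in>X. F g)"
  by (rule sum.reindex_bij_witness[of _ "\<lambda>g. g \<circ> swap x y" "\<lambda>g. g \<circ> swap x y"])
    (use assms in \<open>auto simp: comp_assoc\<close>)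

lemma card_bij: "card {g :: 'n::finite \<Rightarrow> 'n. bij g} = fact CARD('n)"
proof -
  have "{g :: 'n \<Rightarrow> 'n. bij g} = {g. g permutes UNIV}"
    by (auto simp: permutes_def bij_iff)
  then show ?thesis
    using card_permutations[of "UNIV :: 'n set"] by simp
qed

text \<open>
  The oddness of this number is what the contradiction rests on. Composition with a transposition
  away from \<open>a\<close> exchanges odd and even permutations that move \<open>a\<close>, so exactly half of the
  \<open>24 - 6\<close> such permutations are odd.
\<close>

lemma card_odd_moving_point:
  fixes a :: "'n::finite"
  assumes "CARD('n) = 4"
  shows "card {g :: 'n \<Rightarrow> 'n. (bij g \<and> g a \<noteq> a) \<and> sign g = - 1} = 9"
proof -
  let ?G = "{g :: 'n \<Rightarrow> 'n. bij g \<and> g a \<noteq> a}"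
  let ?O = "{g \<in> ?G. sign g = - 1}" and ?E = "{g \<in> ?G. sign g = 1}"
  have all: "card {g :: 'n \<Rightarrow> 'n. bij g} = 24"
    using assms by (simp add: card_bij fact_numeral)
  have "{g :: 'n \<Rightarrow> 'n. bij g \<and> g a = a} = {g. g permutes (UNIV - {a})}"
    by (auto simp: permutes_def bij_iff)
  then have fixing: "card {g :: 'n \<Rightarrow> 'n. bij g \<and> g a = a} = 6"
    using card_permutations[of "UNIV - {a}" 3] assms by (simp add: fact_numeral card_Diff_singleton)
  have "?G = {g. bij g} - {g. bij g \<and> g a = a}"
    by auto
  then have "card ?G = 18"
    by (simp only:) (subst card_Diff_subset, auto simp: all fixing)
  have "2 \<le> card (UNIV - {a})"
    using assms by (simp add: card_Diff_singleton)
  then obtain T where "T \<subseteq> UNIV - {a}" "card T = 2"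
    by (metis obtain_subset_with_card_n)
  then obtain x y where xy: "x \<noteq> y" "x \<noteq> a" "y \<noteq> a"
    by (auto simp: card_2_iff)
  have "bij_betw (\<lambda>g. g \<circ> swap x y) ?O ?E"
    by (rule bij_betw_byWitness[of _ "\<lambda>g. g \<circ> swap x y"])
      (use xy in \<open>auto simp: comp_assoc sign_comp_swap bij_comp transpose_apply_other\<close>)
  then have "card ?O = card ?E"
    by (rule bij_betw_same_card)
  moreover have "card ?G = card ?O + card ?E"
  proof -
    have "sign g = 1 \<or> sign g = - 1" for g :: "'n \<Rightarrow> 'n"
      by (cases g rule: sign_cases) auto
    then have "?G = ?O \<union> ?E"
      by blast
    then have "card ?G = card (?O \<union> ?E)"
      by (rule arg_cong)
    also have "\<dots> = card ?O + card ?E"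
      by (rule card_Un_disjoint) auto
    finally show ?thesis .
  qed
  ultimately show ?thesis
    using \<open>card ?G = 18\<close> by simp
qed

text \<open>
  Fix a point \<open>a\<close>. For \<open>j \<noteq> a\<close>, the permutations that send neither \<open>a\<close> nor \<open>j\<close> to \<open>a\<close>
  are a union of squares of the kind in the hypothesis, with \<open>{a, j}\<close> as one of the two pairs; the
  signs alternate around a square, so the signed sum of \<open>H\<close> over them is zero. Adding this up over
  the three values of \<open>j\<close> counts every permutation that moves \<open>a\<close> exactly twice, since of the three
  \<open>j\<close> only the preimage of \<open>a\<close> is left out. Hence the signed sum of \<open>H\<close> over the permutations that move \<open>a\<close>
  is exactly zero, and its exponential is 1. But a factor of that exponential is the
  sign of its permutation, and there are nine odd ones.
\<close>

lemma no_square_balanced_logarithm_of_sign: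
  fixes H :: "('n::finite \<Rightarrow> 'n) \<Rightarrow> complex"
  assumes card: "CARD('n) = 4"
    and exp: "\<And>g. bij g \<Longrightarrow> exp (H g) = of_int (sign g)"
    and square: "\<And>g a b c d. bij g \<Longrightarrow> UNIV = {a, b, c, d} \<Longrightarrow> distinct [a, b, c, d] \<Longrightarrow>
      H g + H (g \<circ> swap a b \<circ> swap c d) = H (g \<circ> swap a b) + H (g \<circ> swap c d)"
  shows False
proof -
  obtain xs :: "'n list" where xs: "set xs = UNIV" "distinct xs"
    using finite_distinct_list[OF finite] by metis
  then have "length xs = 4"
    using card by (metis distinct_card)
  then obtain a b c d where "xs = [a, b, c, d]"
    by (auto simp: numeral_eq_Suc length_Suc_conv)
  with xs have abcd: "UNIV = {a, b, c, d}" "distinct [a, b, c, d]"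
    by auto
  define f where "f g = of_int (sign g) * H g" for g
  define G where "G = {g :: 'n \<Rightarrow> 'n. bij g \<and> g a \<noteq> a}"
  have zero: "sum f {g \<in> G. g j \<noteq> a} = 0" if "j \<noteq> a" for j
  proof -
    let ?X = "{g \<in> G. g j \<noteq> a}"
    obtain k l where kl: "UNIV = {a, j, k, l}" "distinct [a, j, k, l]"
    proof -
      have "j = b \<or> j = c \<or> j = d"
        using abcd(1) \<open>j \<noteq> a\<close> by (metis UNIV_I insertE singletonD)
      then show ?thesis
        using abcd that[of c d] that[of b d] that[of b c] by (auto simp: insert_commute)
    qed
    \<comment> \<open>Both involutions that generate the squares preserve the index set.\<close>
    have s1: "g \<circ> swap a j \<in> ?X" if "g \<in> ?X" for g
      using that by (auto simp: G_def bij_comp)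
    have s2: "g \<circ> swap k l \<in> ?X" if "g \<in> ?X" for g
      using that kl(2) by (auto simp: G_def bij_comp transpose_apply_other)
    have s1': "(\<Sum>g\<in>?X. f (g \<circ> swap a j)) = sum f ?X"
      by (rule sum_comp_swap[OF s1])
    have s2': "(\<Sum>g\<in>?X. f (g \<circ> swap k l)) = sum f ?X"
      by (rule sum_comp_swap[OF s2])
    have "(\<Sum>g\<in>?X. f (g \<circ> swap a j \<circ> swap k l)) = (\<Sum>g\<in>?X. f (g \<circ> swap k l \<circ> swap a j))"
      using kl(2) by (intro sum.cong arg_cong[of _ _ f]) (auto simp: fun_eq_iff Transposition.transpose_def)
    also have "\<dots> = (\<Sum>g\<in>?X. f (g \<circ> swap a j))"
      using sum_comp_swap[OF s2, where F = "\<lambda>g. f (g \<circ> swap a j)"] by simp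
    finally have s3: "(\<Sum>g\<in>?X. f (g \<circ> swap a j \<circ> swap k l)) = sum f ?X"
      by (simp only: s1')
    have "f g + f (g \<circ> swap a j \<circ> swap k l) + f (g \<circ> swap a j) + f (g \<circ> swap k l) = 0"
      if "g \<in> ?X" for g
    proof -
      have g: "bij g"
        using that by (simp add: G_def)
      have "f g + f (g \<circ> swap a j \<circ> swap k l) + f (g \<circ> swap a j) + f (g \<circ> swap k l) =
          of_int (sign g) * ((H g + H (g \<circ> swap a j \<circ> swap k l)) - (H (g \<circ> swap a j) + H (g \<circ> swap k l)))"
        using kl(2) g by (simp add: f_def sign_comp_swap bij_comp algebra_simps)
      also have "\<dots> = 0"
        using square[OF g kl] by simp
      finally show ?thesis .
    qed
    then have "(\<Sum>g\<in>?X. f g + f (g \<circ> swap a j \<circ> swap k l) + f (g \<circ> swap a j) + f (g \<circ> swap k l)) = 0"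
      by (intro sum.neutral) blast
    then have "4 * sum f ?X = 0"
      by (simp add: sum.distrib s1' s2' s3)
    then show ?thesis
      by simp
  qed
  have "(\<Sum>j\<in>UNIV - {a}. sum f {g \<in> G. g j \<noteq> a}) = (\<Sum>g\<in>G. \<Sum>j | j \<in> UNIV - {a} \<and> g j \<noteq> a. f g)"
    by (rule sum.swap_restrict) auto
  also have "\<dots> = (\<Sum>g\<in>G. 2 * f g)"
  proof (rule sum.cong)
    fix g assume "g \<in> G"
    then have g: "bij g" "g a \<noteq> a"
      by (auto simp: G_def)
    then obtain i where i: "g i = a" "\<And>j. g j = a \<Longrightarrow> j = i"
      by (metis bij_pointE)
    then have "{j. j \<in> UNIV - {a} \<and> g j \<noteq> a} = UNIV - {a, i}"
      by blast
    moreover have "a \<noteq> i"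
      using g(2) i(1) by blast
    then have "card (UNIV - {a, i}) = 2"
      using card by (subst card_Diff_subset) auto
    ultimately show "(\<Sum>j | j \<in> UNIV - {a} \<and> g j \<noteq> a. f g) = 2 * f g"
      by simp
  qed simp
  finally have "sum f G = 0"
    by (simp add: zero flip: sum_distrib_left)
  then have "1 = exp (sum f G)"
    by simp
  also have "\<dots> = (\<Prod>g\<in>G. exp (f g))"
    by (simp add: exp_sum)
  also have "\<dots> = (\<Prod>g\<in>G. if sign g = - 1 then - 1 else 1)"
  proof (rule prod.cong)
    fix g assume "g \<in> G"
    then have "exp (H g) = of_int (sign g)"
      using exp by (simp add: G_def)
    then show "exp (f g) = (if sign g = - 1 then - 1 else 1)"
      by (cases g rule: sign_cases) (simp_all add: f_def exp_minus)
  qed simp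
  also have "\<dots> = (- 1) ^ card {g \<in> G. sign g = - 1}"
    by (simp add: prod.If_cases Int_def)
  also have "\<dots> = - 1"
    using card_odd_moving_point[OF card, of a] by (simp add: G_def)
  finally show False
    by simp
qed


section \<open>Weakly admissible maps are block unitary\<close>

lemma carrier_Sym: "carrier Sym = {g :: 'n::finite \<Rightarrow> 'n. bij g}"
  by (auto simp: BijGroup_def Bij_def)

lemma exists_vertex_seq:
  fixes S :: "('n::finite \<Rightarrow> 'n) set"
  assumes r: "linear_order_on (carrier Sym) r" and "S \<subseteq> carrier Sym" "S \<noteq> {}"
  obtains gs where "vertex_seq r gs" "set gs = S" "length gs = card S"
proof -
  have "finite S"
    by simp
  then have "\<exists>gs. set gs = S \<and> distinct gs \<and> sorted_wrt (\<lambda>g h. (g, h) \<in> r \<and> g \<noteq> h) gs"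
    using \<open>S \<subseteq> carrier Sym\<close>
  proof (induction S)
    case empty
    then show ?case
      by simp
  next
    case (insert x S)
    then obtain gs where gs: "set gs = S" "distinct gs" "sorted_wrt (\<lambda>g h. (g, h) \<in> r \<and> g \<noteq> h) gs"
      by auto
    have "trans r" "total_on (carrier Sym) r"
      using r by (auto simp: order_on_defs)
    then have total: "(x, y) \<in> r" if "y \<in> S" "(y, x) \<notin> r" for y
    proof -
      have "x \<in> carrier Sym" "y \<in> carrier Sym" "x \<noteq> y"
        using insert.prems insert.hyps that by auto
      with \<open>total_on (carrier Sym) r\<close> that show ?thesis
        unfolding total_on_def by metis
    qed
    have step: "(y, z) \<in> r" if "z \<in> S" "(y, x) \<in> r" "(z, x) \<notin> r" for y z
      using transD[OF \<open>trans r\<close> that(2) total[OF that(1,3)]] .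
    have x: "x \<notin> set gs"
      using gs insert by simp
    let ?gs = "filter (\<lambda>y. (y, x) \<in> r) gs @ x # filter (\<lambda>y. (y, x) \<notin> r) gs"
    have "sorted_wrt (\<lambda>g h. (g, h) \<in> r \<and> g \<noteq> h) ?gs"
      using gs x total step by (auto simp: sorted_wrt_append sorted_wrt_filter)
    moreover have "distinct ?gs" "set ?gs = insert x S"
      using gs x by auto
    ultimately show ?case
      by blast
  qed
  then obtain gs where gs: "set gs = S" "distinct gs" "sorted_wrt (\<lambda>g h. (g, h) \<in> r \<and> g \<noteq> h) gs"
    by blast
  moreover have "gs \<noteq> []"
    using gs(1) \<open>S \<noteq> {}\<close> by auto
  ultimately show thesis
    using \<open>S \<subseteq> carrier Sym\<close> distinct_card[of gs] by (intro that[of gs]) (simp_all add: vertex_seq_def)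
qed

lemma mult_Sym:
  fixes g h :: "'n::finite \<Rightarrow> 'n"
  assumes "bij g" "bij h"
  shows "g \<otimes>\<^bsub>Sym\<^esub> h = g \<circ> h"
  using assms by (simp add: BijGroup_def Bij_def compose_def fun_eq_iff)

lemma inv_Sym:
  fixes g :: "'n::finite \<Rightarrow> 'n"
  assumes "bij g"
  shows "inv\<^bsub>Sym\<^esub> g = inv_into UNIV g"
  using assms by (subst inv_BijGroup) (auto simp: Bij_def)

text \<open>
  If all vertices map \<open>B\<close> onto the same set, then every \<open>g\<^sub>0\<^sup>-\<^sup>1g\<close> preserves \<open>B\<close>, hence so does
  the subgroup that they generate, and \<open>B\<close> is a union of its orbits.
\<close>

lemma orbit_partition_preserves:
  fixes gs :: "('n::finite \<Rightarrow> 'n) list"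
  assumes "gs \<noteq> []" "set gs \<subseteq> carrier Sym" and img: "\<And>g. g \<in> set gs \<Longrightarrow> g ` B = B'"
    and C: "C \<in> orbit_partition gs" "i \<in> C" "j \<in> C"
  shows "i \<in> B \<longleftrightarrow> j \<in> B"
proof -
  let ?K = "(\<lambda>g. inv\<^bsub>Sym\<^esub> (hd gs) \<otimes>\<^bsub>Sym\<^esub> g) ` set (tl gs)"
  have mem: "g x \<in> B' \<longleftrightarrow> x \<in> B" if "g \<in> set gs" for g x
  proof -
    have "inj g"
      using assms(2) that by (auto simp: carrier_Sym bij_is_inj)
    then show ?thesis
      using inj_image_mem_iff[of g x B] img[OF that] by simp
  qed
  have K: "bij k \<and> (\<forall>x. k x \<in> B \<longleftrightarrow> x \<in> B)" if k: "k \<in> ?K" for k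
  proof -
    obtain g where g: "g \<in> set gs" "k = inv\<^bsub>Sym\<^esub> (hd gs) \<otimes>\<^bsub>Sym\<^esub> g"
      using k list.set_sel(2)[OF \<open>gs \<noteq> []\<close>] by blast
    have b: "bij (hd gs)" "bij g"
      using g assms by (auto simp: carrier_Sym subset_iff)
    then have k: "k = inv_into UNIV (hd gs) \<circ> g"
      using g by (simp add: mult_Sym inv_Sym bij_imp_bij_inv)
    have "hd gs (k x) = g x" for x
      using b by (simp add: k bij_is_surj surj_f_inv_f)
    then have "k x \<in> B \<longleftrightarrow> x \<in> B" for x
      using mem[OF g(1), of x] mem[of "hd gs" "k x"] \<open>gs \<noteq> []\<close> by simp
    then show ?thesis
      using b by (simp add: k bij_comp bij_imp_bij_inv)
  qed
  have gen: "bij s \<and> (\<forall>x. s x \<in> B \<longleftrightarrow> x \<in> B)" if "s \<in> generate Sym ?K" for s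
    using that
  proof (induction rule: generate.induct)
    case one
    then show ?case
      by (simp add: BijGroup_def bij_def)
  next
    case (incl k)
    then show ?case
      by (rule K)
  next
    case (inv k)
    then have k: "bij k" "\<And>x. k x \<in> B \<longleftrightarrow> x \<in> B"
      using K by auto
    have "inv_into UNIV k x \<in> B \<longleftrightarrow> x \<in> B" for x
      using k(2)[of "inv_into UNIV k x"] k(1) by (simp add: bij_is_surj surj_f_inv_f)
    then show ?case
      using k(1) by (simp add: inv_Sym bij_imp_bij_inv)
  next
    case (eng s t)
    then have "s \<otimes>\<^bsub>Sym\<^esub> t = s \<circ> t" "bij (s \<circ> t)"
      by (blast intro: mult_Sym bij_comp)+
    then show ?case
      using eng.IH by (metis comp_apply)
  qed
  obtain x s t where "i = s x" "j = t x" "s \<in> generate Sym ?K" "t \<in> generate Sym ?K"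
    using C by (auto simp: orbit_partition_def orbits_def orbit_def)
  then show ?thesis
    using gen by blast
qed

lemma perm_mat_mult:
  assumes "inj g"
  shows "(perm_mat g ** A) $ g i $ j = A $ i $ j"
proof -
  have "(\<Sum>k\<in>UNIV. perm_mat g $ g i $ k * A $ k $ j) = (\<Sum>k\<in>UNIV. if k = i then A $ i $ j else 0)"
    using assms by (intro sum.cong) (auto simp: perm_mat_def inj_eq)
  then show ?thesis
    by (simp add: matrix_matrix_mult_def)
qed

text \<open>
  Admissibility on the 2-skeleton speaks of triangles; with at least three permutations every
  vertex and every edge is a face of some triangle, and so lies in the 2-skeleton.
\<close>

lemma weakly_admissible_imp_block_unitary_field:
  fixes u :: "real ^ ('n::finite \<Rightarrow> 'n) \<Rightarrow> complex ^ 'n ^ 'n"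
  assumes r: "linear_order_on (carrier Sym) r" and u: "weakly_admissible r (skeleton r 2) u"
    and three: "3 \<le> card {g :: 'n \<Rightarrow> 'n. bij g}"
  shows "block_unitary_field u"
proof -
  have face: "face (set gs) = subsimplex gs" for gs :: "('n \<Rightarrow> 'n) list"
    by (simp add: subsimplex_def)
  have sub: "face S \<subseteq> skeleton r 2" if S: "S \<subseteq> {g. bij g}" "card S \<le> 3" for S :: "('n \<Rightarrow> 'n) set"
  proof -
    obtain T where T: "S \<subseteq> T" "T \<subseteq> {g. bij g}" "card T = 3"
      using exists_subset_between[OF S(2) three S(1)] by auto
    then obtain gs where "vertex_seq r gs" "set gs = T" "length gs = 3"
      using exists_vertex_seq[OF r, of T] by (force simp: carrier_Sym)
    then have "face T \<subseteq> skeleton r 2"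
      unfolding skeleton_def using face[of gs] by (intro Union_upper) auto
    moreover have "face S \<subseteq> face T"
      using T by (intro hull_mono) auto
    ultimately show ?thesis
      by blast
  qed
  show ?thesis
  proof
    fix S :: "('n \<Rightarrow> 'n) set"
    assume S: "S \<subseteq> {g. bij g}" "S \<noteq> {}" "card S \<le> 3"
    show "continuous_on (face S) u"
      using u sub[OF S(1,3)] by (auto simp: weakly_admissible_def intro: continuous_on_subset)
    fix x assume x: "x \<in> face S"
    show "u x \<in> unitary_mats"
      using u sub[OF S(1,3)] x by (auto simp: weakly_admissible_def)
    fix B B' i j assume img: "\<And>g. g \<in> S \<Longrightarrow> g ` B = B'" and ij: "(j \<in> B) \<noteq> (i \<in> B')"
    have "S \<subseteq> carrier Sym"
      using S by (simp add: carrier_Sym)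
    then obtain gs where gs: "vertex_seq r gs" "set gs = S"
      using exists_vertex_seq[OF r _ S(2)] by blast
    then have "u ` subsimplex gs \<subseteq> (\<lambda>A. perm_mat (hd gs) ** A) ` block_unitary_mats (orbit_partition gs)"
      using u sub[OF S(1,3)] face[of gs] by (auto simp: weakly_admissible_def)
    then obtain A where A: "u x = perm_mat (hd gs) ** A" "A \<in> block_unitary_mats (orbit_partition gs)"
      using x face[of gs] gs(2) by auto
    have "gs \<noteq> []"
      using gs S by auto
    then have hd: "hd gs \<in> S"
      using gs(2) by auto
    then have "bij (hd gs)"
      using S by auto
    then obtain k where k: "i = hd gs k"
      by (metis bij_pointE)
    have "k \<in> B \<longleftrightarrow> i \<in> B'"
      using inj_image_mem_iff[OF bij_is_inj[OF \<open>bij (hd gs)\<close>], of k B] img[OF hd] k by simp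
    then have "\<not> (\<exists>C\<in>orbit_partition gs. k \<in> C \<and> j \<in> C)"
      using orbit_partition_preserves[OF \<open>gs \<noteq> []\<close>, of B B' _ k j] gs(2) S img ij by (auto simp: carrier_Sym)
    then have "A $ k $ j = 0"
      using A(2) by (auto simp: block_unitary_mats_def)
    then show "u x $ i $ j = 0"
      using A(1) k perm_mat_mult[OF bij_is_inj[OF \<open>bij (hd gs)\<close>], of A k j] by simp
  qed
qed

theorem theorem4p7:
  fixes r :: "(4 \<Rightarrow> 4) rel"
  assumes "linear_order_on (carrier Sym) r"
  shows "\<not> (\<exists>u :: real ^ (4 \<Rightarrow> 4) \<Rightarrow> complex ^ 4 ^ 4. weakly_admissible r (skeleton r 2) u)"
proof
  assume "\<exists>u :: real ^ (4 \<Rightarrow> 4) \<Rightarrow> complex ^ 4 ^ 4. weakly_admissible r (skeleton r 2) u"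
  then obtain u :: "real ^ (4 \<Rightarrow> 4) \<Rightarrow> complex ^ 4 ^ 4" where u: "weakly_admissible r (skeleton r 2) u" ..
  have "3 \<le> card {g :: 4 \<Rightarrow> 4. bij g}"
    by (simp add: card_bij fact_numeral)
  then interpret block_unitary_field u
    by (rule weakly_admissible_imp_block_unitary_field[OF assms u])
  show False
    by (rule no_square_balanced_logarithm_of_sign[of log_defect])
      (simp_all add: exp_log_defect log_defect_square)
qed

end
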